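(* Let $\mathbf{X}$ be a $p$-dimensional random vector and $Y$ a real random variable such that $(\mathbf{X},Y)\sim N(\mathbf{0},\Sigma)$ with covariance matrix $\Sigma=\begin{pmatrix}\Sigma_{11}&\Sigma_{12}\\ \Sigma_{21}&\sigma_Y^2\end{pmatrix}$ (with $\Sigma_{11}$ the $p\times p$ covariance matrix of $\mathbf{X}$) and $\sigma_Y>0$. Then $$\xi(Y,\mathbf{X})=\frac{3}{\pi}\arcsin\Big(\frac{1+\rho^2}{2}\Big)-\frac12,\qquad\text{with } \rho=\sqrt{\Sigma_{21}\Sigma_{11}^{-}\Sigma_{12}/\sigma_Y^2},$$ where $\Sigma_{11}^{-}$ denotes a generalized inverse of $\Sigma_{11}$ such as the Moore–Penrose inverse.
   Context: For a non-degenerate real random variable $Y$ (not almost surely constant) with distribution $P^Y$ and a random vector $\mathbf{X}$, $$\xi(Y,\mathbf{X}):=\frac{\int_{\mathbb{R}}\mathrm{Var}\big(P(Y\ge y\mid\mathbf{X})\big)\,\mathrm{d}P^{Y}(y)}{\int_{\mathbb{R}}\mathrm{Var}\big(\mathbf{1}_{\{Y\ge y\}}\big)\,\mathrm{d}P^{Y}(y)}.$$ The matrix $\Sigma_{11}$ may be singular. *)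

theory Defs
  imports "HOL-Probability.Probability"
begin

definition std_gaussian :: "(real^'n::finite) measure" where
  "std_gaussian = density lborel (\<lambda>w. ennreal (\<Prod>i\<in>UNIV. std_normal_density (w $ i)))"

text \<open>
  \<open>Z \<sim> N(\<mu>, S)\<close>, where the covariance matrix \<open>S\<close> may be singular: \<open>Z\<close> is distributed as
  \<open>\<mu> + A W\<close> with \<open>W\<close> a vector of independent standard normal variables and \<open>A A\<^sup>T = S\<close>.
  Restricting to square \<open>A\<close> loses nothing, since every covariance matrix has a square root;
  the law of \<open>\<mu> + A W\<close> depends on \<open>A\<close> only through \<open>A A\<^sup>T\<close>.
\<close>

definition multivariate_normal ::
    "'a measure \<Rightarrow> ('a \<Rightarrow> real^'n::finite) \<Rightarrow> real^'n \<Rightarrow> real^'n^'n \<Rightarrow> bool" where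
  "multivariate_normal M Z \<mu> S \<longleftrightarrow>
     Z \<in> borel_measurable M \<and>
     (\<exists>A :: real^'n^'n. A ** transpose A = S \<and>
        distr M borel Z = distr std_gaussian borel (\<lambda>w. \<mu> + A *v w))"

definition append_scalar :: "real^'p::finite \<Rightarrow> real \<Rightarrow> real^('p + unit)" where
  "append_scalar x y = (\<chi> i. case i of Inl j \<Rightarrow> x $ j | Inr _ \<Rightarrow> y)"

text \<open>In \<open>bordered_matrix A b c d\<close>, \<open>b\<close> is the upper right column and \<open>c\<close> the lower left row.\<close>

definition bordered_matrix ::
    "real^'p^'p \<Rightarrow> real^'p \<Rightarrow> real^'p \<Rightarrow> real \<Rightarrow> real^('p::finite + unit)^('p + unit)" where
  "bordered_matrix A b c d =
     (\<chi> i j. case i of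
        Inl k \<Rightarrow> (case j of Inl l \<Rightarrow> A $ k $ l | Inr _ \<Rightarrow> b $ k)
      | Inr _ \<Rightarrow> (case j of Inl l \<Rightarrow> c $ l | Inr _ \<Rightarrow> d))"

text \<open>
  Generalized inverses in the weakest usual sense (inner inverses). They are not unique;
  the Moore--Penrose inverse is one of them.
\<close>

definition generalized_inverse :: "real^'n^'m \<Rightarrow> real^'m^'n \<Rightarrow> bool" where
  "generalized_inverse A G \<longleftrightarrow> A ** G ** A = A"

text \<open>\<open>P(B | X)\<close>: a version of the conditional probability of \<open>B\<close> given \<open>\<sigma>(X)\<close>.\<close>

definition cond_prob_given ::
    "'a measure \<Rightarrow> ('a \<Rightarrow> 'b::topological_space) \<Rightarrow> 'a set \<Rightarrow> 'a \<Rightarrow> real" where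
  "cond_prob_given M X B = real_cond_exp M (vimage_algebra (space M) X borel) (indicator B)"

definition xi :: "'a measure \<Rightarrow> ('a \<Rightarrow> real) \<Rightarrow> ('a \<Rightarrow> 'b::topological_space) \<Rightarrow> real" where
  "xi M Y X =
     (LINT y|distr M borel Y.
        prob_space.variance M (cond_prob_given M X {\<omega> \<in> space M. Y \<omega> \<ge> y})) /
     (LINT y|distr M borel Y.
        prob_space.variance M (indicator {\<omega> \<in> space M. Y \<omega> \<ge> y}))"

end

theory Submission
  imports Defs
begin

text \<open>
  With \<open>\<beta> = \<Sigma>\<^sub>1\<^sub>1\<^sup>- \<Sigma>\<^sub>1\<^sub>2\<close>, the residual \<open>Y - \<beta> \<bullet> X\<close> is uncorrelated with \<open>X\<close>, hence independent
  of it and \<open>N(0, \<eta>\<^sup>2)\<close>-distributed, while \<open>\<beta> \<bullet> X \<sim> N(0, \<tau>\<^sup>2)\<close> with \<open>\<tau> = \<rho> \<sigma>\<^sub>Y\<close> and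
  \<open>\<tau>\<^sup>2 + \<eta>\<^sup>2 = \<sigma>\<^sub>Y\<^sup>2\<close>. So \<open>P(Y \<ge> y | X)\<close> is the tail of \<open>N(0, \<eta>\<^sup>2)\<close> at \<open>y - \<beta> \<bullet> X\<close>. Its second
  moment, integrated over \<open>y \<sim> P\<^sup>Y\<close>, is the probability that two copies of \<open>Y\<close> sharing \<open>X\<close> both
  exceed a third independent one, that is, an orthant probability for a Gaussian pair with correlation
  \<open>(1 + \<rho>\<^sup>2) / 2\<close>. Sheppard's formula \<open>1/4 + arcsin r / (2 \<pi>)\<close> evaluates it; the cases \<open>\<rho> = 0\<close> and
  \<open>\<rho> = 1\<close> of the same integral give the values 1/3 and 1/2 entering the denominator. Independence is
  obtained from the rotation invariance of the standard Gaussian measure.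
\<close>

section \<open>Rotation invariance of Lebesgue measure and of the standard Gaussian measure\<close>

text \<open>The image measure inherits translation invariance because \<open>g\<close> is additive
  and onto, and it gives balls around 0 their Lebesgue measure because \<open>g\<close> preserves
  the norm. These two properties already determine it.\<close>

lemma distr_lborel_orthogonal_transformation:
  fixes g :: "'a::euclidean_space \<Rightarrow> 'a"
  assumes g: "orthogonal_transformation g"
  shows "distr lborel borel g = lborel"
proof (rule measure_eqI)
  let ?\<mu> = "distr lborel borel g"
  have lin: "linear g"
    using g by (simp add: orthogonal_transformation_def)
  have gm[measurable]: "g \<in> borel_measurable borel"
    by (intro borel_measurable_continuous_onI linear_continuous_on linear_conv_bounded_linear[THEN iffD1] lin)
  have ball: "emeasure ?\<mu> (ball 0 r) = emeasure lborel (ball 0 r :: 'a set)" for r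
  proof -
    have "g -` ball 0 r = ball 0 r"
      using g by (auto simp: orthogonal_transformation)
    then show ?thesis
      by (simp add: emeasure_distr)
  qed
  have shift: "(\<integral>\<^sup>+x. f (x + a) \<partial>lborel) = (\<integral>\<^sup>+x. f x \<partial>lborel)"
    if [measurable]: "f \<in> borel_measurable borel" for f and a :: 'a
  proof -
    have "(\<integral>\<^sup>+x. f x \<partial>lborel) = (\<integral>\<^sup>+x. f x \<partial>distr lborel borel ((+) a))"
      by (simp add: lborel_distr_plus)
    then show ?thesis
      by (simp add: nn_integral_distr add.commute)
  qed
  have shift\<mu>: "(\<integral>\<^sup>+x. f (x + a) \<partial>?\<mu>) = (\<integral>\<^sup>+x. f x \<partial>?\<mu>)"
    if [measurable]: "f \<in> borel_measurable borel" for f a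
  proof -
    obtain b where b: "a = g b"
      using orthogonal_transformation_surj[OF g] by blast
    have "(\<integral>\<^sup>+x. f (x + a) \<partial>?\<mu>) = (\<integral>\<^sup>+x. f (g (x + b)) \<partial>lborel)"
      by (simp add: nn_integral_distr b linear_add[OF lin])
    also have "\<dots> = (\<integral>\<^sup>+x. f x \<partial>?\<mu>)"
      by (simp add: shift[of "\<lambda>x. f (g x)"] nn_integral_distr)
    finally show ?thesis .
  qed
  have refl: "(\<integral>\<^sup>+x. f (a - x) \<partial>lborel) = (\<integral>\<^sup>+x. f x \<partial>lborel)"
    if [measurable]: "f \<in> borel_measurable borel" for f and a :: 'a
  proof -
    have "(\<integral>\<^sup>+x. f x \<partial>lborel) = (\<integral>\<^sup>+x. f x \<partial>distr lborel borel (\<lambda>x. a + (-1) *\<^sub>R x))"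
      by (subst (1) lborel_affine[of "-1" a]) (simp_all add: density_1)
    then show ?thesis
      by (simp add: nn_integral_distr)
  qed
  have "sigma_finite_measure ?\<mu>"
  proof
    show "\<exists>A. countable A \<and> A \<subseteq> sets ?\<mu> \<and> \<Union>A = space ?\<mu> \<and> (\<forall>a\<in>A. emeasure ?\<mu> a \<noteq> \<infinity>)"
    proof (intro exI[of _ "range (\<lambda>n::nat. ball 0 (real n))"] conjI)
      show "\<Union> (range (\<lambda>n::nat. ball 0 (real n))) = space ?\<mu>"
        using reals_Archimedean2 by auto
    qed (use emeasure_lborel_ball_finite ball in \<open>auto simp: less_top\<close>)
  qed
  then interpret \<mu>: sigma_finite_measure ?\<mu> .
  interpret pair_sigma_finite lborel ?\<mu> ..
  show "sets ?\<mu> = sets lborel"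
    by simp
  fix A assume "A \<in> sets ?\<mu>"
  then have [measurable]: "A \<in> sets borel"
    by simp
  \<comment> \<open>Uniqueness of translation-invariant measures up to a factor, which the unit ball shows to be 1.\<close>
  let ?B = "ball 0 1 :: 'a set"
  have [measurable]: "?B \<in> sets borel"
    by simp
  have "emeasure ?\<mu> A * emeasure lborel ?B = (\<integral>\<^sup>+x. indicator A x * (\<integral>\<^sup>+y. indicator ?B y \<partial>lborel) \<partial>?\<mu>)"
    by (simp add: nn_integral_multc)
  also have "\<dots> = (\<integral>\<^sup>+x. \<integral>\<^sup>+y. indicator A x * indicator ?B (y + x) \<partial>lborel \<partial>?\<mu>)"
    by (simp add: nn_integral_cmult shift)
  also have "\<dots> = (\<integral>\<^sup>+y. \<integral>\<^sup>+x. indicator A (x + y - y) * indicator ?B (x + y) \<partial>?\<mu> \<partial>lborel)"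
    by (subst Fubini') (simp_all add: add.commute)
  \<comment> \<open>Shifting \<open>x\<close> by \<open>y\<close> under \<open>?\<mu>\<close> leaves
    \<open>y\<close> only in \<open>x - y\<close>, so that reflection and translation invariance of
    Lebesgue measure can integrate it out afterwards.\<close>
  also have "\<dots> = (\<integral>\<^sup>+y. \<integral>\<^sup>+x. indicator A (x - y) * indicator ?B x \<partial>?\<mu> \<partial>lborel)"
    by (subst shift\<mu>[of "\<lambda>x. indicator A (x - y) * indicator ?B x" for y]) simp_all
  also have "\<dots> = (\<integral>\<^sup>+x. \<integral>\<^sup>+y. indicator A (x - y) * indicator ?B x \<partial>lborel \<partial>?\<mu>)"
    by (subst Fubini') simp_all
  also have "\<dots> = (\<integral>\<^sup>+x. emeasure lborel A * indicator ?B x \<partial>?\<mu>)"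
    by (simp add: nn_integral_multc refl)
  also have "\<dots> = emeasure lborel A * emeasure lborel ?B"
    by (simp add: nn_integral_cmult ball)
  \<comment> \<open>The common factor can be cancelled: the unit ball has finite measure and, being
    open and nonempty, is not null.\<close>
  finally show "emeasure ?\<mu> A = emeasure lborel A"
    using emeasure_lborel_ball_finite[of "0::'a" 1] open_not_negligible[of ?B]
    by (auto simp: ennreal_mult_cancel_left mult.commute[of _ "emeasure lborel ?B"]
        negligible_iff_null_sets null_sets_def null_sets_completion_iff less_top)
qed

lemma std_gaussian_eq: "std_gaussian = density lborel (\<lambda>w. ennreal (\<Prod>b\<in>Basis. std_normal_density (w \<bullet> b)))"
proof -
  have *: "(\<Prod>i\<in>UNIV. std_normal_density (w $ i)) = (\<Prod>b\<in>Basis. std_normal_density (w \<bullet> b))" for w :: "real^'n"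
    unfolding Basis_vec_def
    by (subst prod.reindex_bij_witness[where i="\<lambda>b. SOME i. b = axis i 1" and j="\<lambda>i. axis i (1::real)" and T="\<Union>i. {axis i (1::real)}" and S=UNIV and h="\<lambda>b. std_normal_density (w \<bullet> b)"])
      (auto simp: inner_axis axis_eq_axis)
  show ?thesis
    by (simp add: std_gaussian_def *)
qed

text \<open>Makes visible that the density is radial, hence unchanged by orthogonal maps.\<close>

lemma prod_std_normal_density:
  fixes w :: "'a::euclidean_space"
  shows "(\<Prod>b\<in>Basis. std_normal_density (w \<bullet> b)) = (1 / sqrt (2 * pi)) ^ DIM('a) * exp (- (norm w)\<^sup>2 / 2)"
  by (simp only: std_normal_density_def prod.distrib prod_constant exp_sum[symmetric] finite_Basis
       sum_divide_distrib[symmetric] sum_negf norm_eq_sqrt_inner euclidean_inner[of w w] power2_eq_square[symmetric])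
     (simp add: sum_nonneg)

lemma std_gaussian_orthogonal_transformation:
  fixes g :: "real^'n::finite \<Rightarrow> real^'n"
  assumes g: "orthogonal_transformation g"
  shows "distr std_gaussian borel g = std_gaussian"
proof -
  have gm[measurable]: "g \<in> borel_measurable borel"
    using g by (intro borel_measurable_continuous_onI linear_continuous_on linear_conv_bounded_linear[THEN iffD1])
      (simp add: orthogonal_transformation_def)
  define h :: "real^'n \<Rightarrow> ennreal" where "h = (\<lambda>w. ennreal (\<Prod>b\<in>Basis. std_normal_density (w \<bullet> b)))"
  have [measurable]: "h \<in> borel_measurable borel"
    unfolding h_def by measurable
  have "h (g w) = h w" for w
    using g by (simp add: h_def prod_std_normal_density orthogonal_transformation_norm)
  then have "distr (density lborel h) borel g = density (distr lborel borel g) h"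
    by (subst density_distr) simp_all
  then show ?thesis
    by (simp add: std_gaussian_eq h_def distr_lborel_orthogonal_transformation[OF g])
qed

section \<open>Product structure and independence of orthogonal components\<close>

text \<open>\<open>lborel\<close> is itself the image of a product of one-dimensional Lebesgue
  measures, so the density can be pulled back to that product. There it factorizes, which is checked
  on boxes.\<close>

lemma std_gaussian_eq_distr_PiM:
  "(std_gaussian :: (real^'n::finite) measure) =
    distr (\<Pi>\<^sub>M b\<in>Basis. std_normal_distribution) borel (\<lambda>f. \<Sum>b\<in>Basis. f b *\<^sub>R b)"
proof -
  let ?P = "\<Pi>\<^sub>M b\<in>(Basis :: (real^'n) set). (lborel :: real measure)"
  let ?T = "\<lambda>f. \<Sum>b\<in>(Basis :: (real^'n) set). f b *\<^sub>R b"
  interpret L: product_sigma_finite "\<lambda>_ :: real^'n. lborel :: real measure"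
    by standard
  interpret N: prob_space std_normal_distribution
    by (rule prob_space_normal_density) simp
  interpret G: product_sigma_finite "\<lambda>_ :: real^'n. std_normal_distribution"
    by standard
  have "density ?P (\<lambda>f. \<Prod>b\<in>Basis. ennreal (std_normal_density (f b))) = (\<Pi>\<^sub>M b\<in>Basis. std_normal_distribution)"
  proof (rule G.PiM_eqI)
    show "sets (density ?P (\<lambda>f. \<Prod>b\<in>Basis. ennreal (std_normal_density (f b)))) =
      sets (\<Pi>\<^sub>M b\<in>Basis. std_normal_distribution)"
      by (simp cong: sets_PiM_cong)
    fix A :: "real^'n \<Rightarrow> real set"
    assume A: "\<And>b. b \<in> Basis \<Longrightarrow> A b \<in> sets std_normal_distribution"
    then have [measurable]: "Pi\<^sub>E Basis A \<in> sets ?P"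
      by (intro sets_PiM_I_finite) auto
    have "emeasure (density ?P (\<lambda>f. \<Prod>b\<in>Basis. ennreal (std_normal_density (f b)))) (Pi\<^sub>E Basis A) =
        (\<integral>\<^sup>+f. (\<Prod>b\<in>Basis. ennreal (std_normal_density (f b)) * indicator (A b) (f b)) \<partial>?P)"
    proof -
      have "indicator (Pi\<^sub>E Basis A) f = (\<Prod>b\<in>Basis. indicator (A b) (f b) :: ennreal)" if f: "f \<in> space ?P" for f
      proof (cases "f \<in> Pi\<^sub>E Basis A")
        case False
        then obtain b where "b \<in> Basis" "f b \<notin> A b"
          using f False by (auto simp: space_PiM PiE_iff)
        then show ?thesis
          using False by (auto intro!: prod_zero[symmetric] bexI[of _ b])
      qed (auto simp: PiE_iff)
      then show ?thesis
        by (subst emeasure_density) (auto intro!: nn_integral_cong simp: prod.distrib)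
    qed
    also have "\<dots> = (\<Prod>b\<in>Basis. \<integral>\<^sup>+x. ennreal (std_normal_density x) * indicator (A b) x \<partial>lborel)"
      using A by (intro L.product_nn_integral_prod) auto
    also have "\<dots> = (\<Prod>b\<in>Basis. emeasure std_normal_distribution (A b))"
      using A by (intro prod.cong refl) (simp add: emeasure_density)
    finally show "emeasure (density ?P (\<lambda>f. \<Prod>b\<in>Basis. ennreal (std_normal_density (f b)))) (Pi\<^sub>E Basis A) =
      (\<Prod>b\<in>Basis. emeasure std_normal_distribution (A b))" .
  qed simp
  then show ?thesis
    unfolding std_gaussian_eq
    by (subst lborel_eq) (simp add: density_distr prod_ennreal cong: prod.cong)
qed

lemma prob_space_std_gaussian: "prob_space (std_gaussian :: (real^'n::finite) measure)"
  unfolding std_gaussian_eq_distr_PiM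
  by (intro prob_space.prob_space_distr prob_space_PiM prob_space_normal_density) simp_all

lemma sets_std_gaussian [measurable_cong, simp]: "sets std_gaussian = sets borel"
  by (simp add: std_gaussian_def)

lemma distr_snd_prob_space:
  assumes "prob_space A" "prob_space B" 
  shows "distr (A \<Otimes>\<^sub>M B) B snd = B"
proof (rule measure_eqI)
  interpret A: prob_space A by fact
  interpret B: prob_space B by fact
  fix S assume "S \<in> sets (distr (A \<Otimes>\<^sub>M B) B snd)"
  then have S: "S \<in> sets B" by simp
  have "snd -` S \<inter> space (A \<Otimes>\<^sub>M B) = space A \<times> S"
    using sets.sets_into_space[OF S] by (auto simp: space_pair_measure)
  with S show "emeasure (distr (A \<Otimes>\<^sub>M B) B snd) S = emeasure B S"
    by (simp add: emeasure_distr B.emeasure_pair_measure_Times A.emeasure_space_1)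
qed simp

text \<open>A linear map that kills \<open>b\<close> sees only the remaining coordinates, and under
  the product measure these are independent of the coordinate along \<open>b\<close>.\<close>

lemma distr_std_gaussian_Basis:
  fixes f :: "real^'n::finite \<Rightarrow> 'b::euclidean_space"
  assumes f: "linear f" "f b = 0" and b: "b \<in> Basis"
  shows "distr std_gaussian borel (\<lambda>w. (b \<bullet> w, f w)) = std_normal_distribution \<Otimes>\<^sub>M distr std_gaussian borel f"
proof -
  let ?N = std_normal_distribution
  let ?P = "\<Pi>\<^sub>M c\<in>Basis - {b}. ?N"
  define T :: "(real^'n \<Rightarrow> real) \<Rightarrow> real^'n" where "T X = (\<Sum>c\<in>Basis. X c *\<^sub>R c)" for X
  define F where "F X = f (\<Sum>c\<in>Basis - {b}. X c *\<^sub>R c)" for X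
  have [measurable]: "f \<in> borel_measurable borel"
    by (intro borel_measurable_continuous_onI linear_continuous_on linear_conv_bounded_linear[THEN iffD1] f)
  have [measurable]: "F \<in> borel_measurable ?P"
    unfolding F_def by measurable
  have [measurable]: "T \<in> borel_measurable (\<Pi>\<^sub>M c\<in>Basis. ?N)"
    unfolding T_def by measurable
  interpret N: prob_space ?N
    by (rule prob_space_normal_density) simp
  interpret P: prob_space ?P
    by (intro prob_space_PiM N.prob_space_axioms)
  have Basis: "insert b (Basis - {b}) = Basis"
    using b by auto
  have [measurable]: "(\<lambda>(x, X). X(b := x)) \<in> measurable (?N \<Otimes>\<^sub>M ?P) (\<Pi>\<^sub>M c\<in>Basis. ?N)"
    unfolding case_prod_beta' by (rule measurable_fun_upd[where J="Basis - {b}"]) (use Basis in auto)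
  have std: "std_gaussian = distr (?N \<Otimes>\<^sub>M ?P) borel (\<lambda>(x, X). T (X(b := x)))"
  proof -
    have *: "(\<Pi>\<^sub>M c\<in>Basis. ?N) = distr (?N \<Otimes>\<^sub>M ?P) (\<Pi>\<^sub>M c\<in>Basis. ?N) (\<lambda>(x, X). X(b := x))"
      using distr_pair_PiM_eq_PiM[of "Basis - {b}" "\<lambda>_. ?N" b] by (simp add: insert_absorb[OF b] N.prob_space_axioms)
    show ?thesis
      unfolding std_gaussian_eq_distr_PiM T_def[symmetric]
      by (subst * ) (simp add: distr_distr comp_def case_prod_beta')
  qed
  have T: "T (X(b := x)) = x *\<^sub>R b + (\<Sum>c\<in>Basis - {b}. X c *\<^sub>R c)" for x X
    unfolding T_def using b by (subst sum.remove[of _ b]) auto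
  have "(\<Sum>c\<in>Basis - {b}. X c *\<^sub>R c) \<bullet> b = 0" for X
    using b by (simp add: inner_sum_left inner_Basis)
  then have Tb: "b \<bullet> T (X(b := x)) = x" and Tf: "f (T (X(b := x))) = F X" for x X
    using b by (simp_all add: T F_def linear_add[OF f(1)] linear_scale[OF f(1)] f(2) inner_add inner_commute)
  \<comment> \<open>\<open>F\<close> ignores the coordinate along \<open>b\<close>, so its law over
    the full product is its law over the remaining factors.\<close>
  have "distr std_gaussian borel f = distr (?N \<Otimes>\<^sub>M ?P) borel (\<lambda>(x, X). F X)"
    unfolding std by (simp add: distr_distr comp_def case_prod_beta' Tf)
  also have "\<dots> = distr (distr (?N \<Otimes>\<^sub>M ?P) ?P snd) borel F"
    by (simp add: distr_distr comp_def case_prod_beta')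
  finally have "distr std_gaussian borel f = distr ?P borel F"
    by (simp add: distr_snd_prob_space N.prob_space_axioms P.prob_space_axioms)
  then have "?N \<Otimes>\<^sub>M distr std_gaussian borel f = distr ?N borel (\<lambda>x. x) \<Otimes>\<^sub>M distr ?P borel F"
    by (simp add: distr_id2)
  also have "\<dots> = distr (?N \<Otimes>\<^sub>M ?P) (borel \<Otimes>\<^sub>M borel) (\<lambda>(x, X). (x, F X))"
    by (intro pair_measure_distr prob_space_imp_sigma_finite P.prob_space_distr) simp_all
  also have "\<dots> = distr std_gaussian borel (\<lambda>w. (b \<bullet> w, f w))"
    unfolding std by (simp add: distr_distr comp_def case_prod_beta' Tf Tb borel_prod)
  finally show ?thesis ..
qed

text \<open>A rotation \<open>g\<close> taking \<open>norm u *\<^sub>R b\<close> to \<open>u\<close>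
  reduces this to a basis vector: \<open>f \<circ> g\<close> kills \<open>b\<close>, and the
  Gaussian does not notice \<open>g\<close>. Cancelling \<open>norm u\<close> requires
  \<open>u \<noteq> 0\<close>; for \<open>u = 0\<close> the first component is constant on both
  sides.\<close>

lemma distr_std_gaussian_pair:
  fixes f :: "real^'n::finite \<Rightarrow> 'b::euclidean_space"
  assumes f: "linear f" "f u = 0"
  shows "distr std_gaussian borel (\<lambda>w. (u \<bullet> w, f w)) =
    distr std_normal_distribution borel (\<lambda>x. norm u * x) \<Otimes>\<^sub>M distr std_gaussian borel f"
proof -
  let ?N = std_normal_distribution
  interpret N: prob_space ?N
    by (rule prob_space_normal_density) simp
  interpret S: prob_space "std_gaussian :: (real^'n) measure"
    by (rule prob_space_std_gaussian)
  have fm[measurable]: "f \<in> borel_measurable borel"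
    by (intro borel_measurable_continuous_onI linear_continuous_on linear_conv_bounded_linear[THEN iffD1] f)
  have Sf: "prob_space (distr std_gaussian borel f)"
    by (intro S.prob_space_distr) simp
  show ?thesis
  proof (cases "u = 0")
    case True
    have "distr ?N borel (\<lambda>x. norm u * x) \<Otimes>\<^sub>M distr std_gaussian borel f =
        distr (?N \<Otimes>\<^sub>M std_gaussian) (borel \<Otimes>\<^sub>M borel) (\<lambda>(x, w). (norm u * x, f w))"
      by (intro pair_measure_distr prob_space_imp_sigma_finite Sf) simp_all
    also have "\<dots> = distr (distr (?N \<Otimes>\<^sub>M std_gaussian) std_gaussian snd) borel (\<lambda>w. (u \<bullet> w, f w))"
      by (simp add: distr_distr comp_def case_prod_beta' True borel_prod)
    finally show ?thesis
      by (simp add: distr_snd_prob_space N.prob_space_axioms S.prob_space_axioms)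
  next
    case False
    obtain b :: "real^'n" where b: "b \<in> Basis"
      using SOME_Basis by blast
    obtain g where g: "orthogonal_transformation g" "g (norm u *\<^sub>R b) = u"
      using orthogonal_transformation_exists[of "norm u *\<^sub>R b" u] b by auto
    have lin: "linear g"
      using g by (simp add: orthogonal_transformation_def)
    have [measurable]: "g \<in> borel_measurable borel"
      by (intro borel_measurable_continuous_onI linear_continuous_on linear_conv_bounded_linear[THEN iffD1] lin)
    have fg: "linear (f \<circ> g)"
      by (rule linear_compose[OF lin f(1)])
    have "norm u *\<^sub>R (f \<circ> g) b = 0"
      using f(2) g(2) linear_scale[OF fg, of "norm u" b] by simp
    with False have fgb: "(f \<circ> g) b = 0"
      by simp
    have ug: "u \<bullet> g w = norm u * (b \<bullet> w)" for w
    proof -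
      have "u \<bullet> g w = g (norm u *\<^sub>R b) \<bullet> g w"
        by (simp add: g)
      then show ?thesis
        using g(1) by (simp add: orthogonal_transformation_def)
    qed
    have [measurable]: "(\<lambda>x :: real \<times> 'b. (norm u * fst x, snd x)) \<in> borel_measurable borel"
      unfolding borel_prod[symmetric] by measurable
    have dfg: "distr std_gaussian borel (f \<circ> g) = distr std_gaussian borel f"
      using distr_distr[of f borel borel g std_gaussian] by (simp add: std_gaussian_orthogonal_transformation[OF g(1)])
    have "distr std_gaussian borel (\<lambda>w. (u \<bullet> w, f w)) =
        distr (distr std_gaussian borel g) borel (\<lambda>w. (u \<bullet> w, f w))"
      by (simp add: std_gaussian_orthogonal_transformation[OF g(1)])
    also have "\<dots> = distr (distr std_gaussian borel (\<lambda>w. (b \<bullet> w, (f \<circ> g) w))) borel (\<lambda>(x, y). (norm u * x, y))"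
      by (simp add: distr_distr comp_def case_prod_beta' ug)
    also have "\<dots> = distr (?N \<Otimes>\<^sub>M distr std_gaussian borel f) (borel \<Otimes>\<^sub>M borel) (\<lambda>(x, y). (norm u * x, y))"
      by (simp only: distr_std_gaussian_Basis[OF fg fgb b] dfg borel_prod)
    also have "\<dots> = distr ?N borel (\<lambda>x. norm u * x) \<Otimes>\<^sub>M distr (distr std_gaussian borel f) borel (\<lambda>y. y)"
      by (intro pair_measure_distr[symmetric] prob_space_imp_sigma_finite prob_space.prob_space_distr Sf) simp_all
    finally show ?thesis
      by (simp add: distr_id2)
  qed
qed

section \<open>Sheppard's formula for Gaussian orthant probabilities\<close>

text \<open>The two exponents add up to \<open>- (1 + t^2) * x^2 / 2\<close>, and the extra factor
  \<open>x\<close>, the Jacobian of the substitution \<open>y = x * t\<close>, turns the integrand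
  into an exact derivative.\<close>

lemma nn_integral_std_normal_ray:
  "(\<integral>\<^sup>+x. ennreal (x * std_normal_density x * std_normal_density (x * t)) * indicator {0..} x \<partial>lborel)
    = ennreal (1 / (2 * pi) * inverse (1 + t\<^sup>2))"
proof -
  have c: "1 + t\<^sup>2 > 0"
    by (simp add: add_pos_nonneg)
  define F where "F x = - (1 / (2 * pi) * inverse (1 + t\<^sup>2)) * exp (- ((1 + t\<^sup>2) / 2 * x\<^sup>2))" for x
  have dens: "x * std_normal_density x * std_normal_density (x * t) = 1 / (2 * pi) * (x * exp (- ((1 + t\<^sup>2) / 2 * x\<^sup>2)))" for x
  proof -
    have "exp (- x\<^sup>2 / 2) * exp (- (x * t)\<^sup>2 / 2) = exp (- ((1 + t\<^sup>2) / 2 * x\<^sup>2))"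
      by (simp add: exp_add[symmetric] field_simps power_mult_distrib)
    then show ?thesis
      by (simp add: std_normal_density_def field_simps)
  qed
  have "(F \<longlongrightarrow> 0) at_top"
  proof -
    have "filterlim (\<lambda>x::real. (1 + t\<^sup>2) / 2 * x\<^sup>2) at_top at_top"
      using c by (intro filterlim_tendsto_pos_mult_at_top[OF tendsto_const] filterlim_pow_at_top filterlim_ident) auto
    then have "((\<lambda>x. exp (- ((1 + t\<^sup>2) / 2 * x\<^sup>2))) \<longlongrightarrow> 0) at_top"
      by (intro filterlim_compose[OF exp_at_bot] filterlim_uminus_at_bot_at_top[THEN filterlim_compose])
    from tendsto_mult_left[OF this, of "- (1 / (2 * pi) * inverse (1 + t\<^sup>2))"] show ?thesis
      by (simp add: F_def[abs_def])
  qed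
  moreover have "(F has_real_derivative x * std_normal_density x * std_normal_density (x * t)) (at x)" for x
  proof -
    define a where "a = 1 + t\<^sup>2"
    have "((\<lambda>x. - (1 / (2 * pi) * inverse a) * exp (- (a / 2 * x\<^sup>2))) has_real_derivative
        - (1 / (2 * pi) * inverse a) * (exp (- (a / 2 * x\<^sup>2)) * (- (a / 2 * (2 * x))))) (at x)"
      by (auto intro!: derivative_eq_intros)
    moreover have "- (1 / (2 * pi) * inverse a) * (e * (- (a / 2 * (2 * x)))) = 1 / (2 * pi) * (x * e)" for e
      using c by (simp add: a_def[symmetric])
    ultimately have "((\<lambda>x. - (1 / (2 * pi) * inverse a) * exp (- (a / 2 * x\<^sup>2))) has_real_derivative
        1 / (2 * pi) * (x * exp (- (a / 2 * x\<^sup>2)))) (at x)"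
      by (simp only:)
    then show ?thesis
      unfolding dens F_def[abs_def] a_def .
  qed
  ultimately have "(\<integral>\<^sup>+x. ennreal (x * std_normal_density x * std_normal_density (x * t)) * indicator {0..} x \<partial>lborel)
      = ennreal (0 - F 0)"
    by (intro nn_integral_FTC_atLeast) auto
  then show ?thesis
    by (simp add: F_def)
qed

text \<open>In terms of \<open>x\<close> and the slope \<open>t = y / x\<close> the wedge is a
  product set. Integrating out \<open>x\<close> leaves half the Cauchy density on slopes from
  \<open>- (r / s)\<close> upwards, with antiderivative \<open>arctan t / (2 * pi)\<close>.\<close>

lemma std_normal_pair_wedge:
  fixes r s :: real
  assumes s: "s > 0"
  shows "emeasure (std_normal_distribution \<Otimes>\<^sub>M std_normal_distribution) {(x, y). 0 \<le> x \<and> 0 \<le> r * x + s * y}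
    = ennreal (1 / 4 + arctan (r / s) / (2 * pi))"
proof -
  let ?N = std_normal_distribution
  let ?\<phi> = std_normal_density
  define k where "k = - (r / s)"
  interpret N: prob_space ?N
    by (rule prob_space_normal_density) simp
  have wedge: "0 \<le> r * x + s * y \<longleftrightarrow> k * x \<le> y" for x y
  proof -
    have "k * x \<le> y \<longleftrightarrow> - (r * x) / s \<le> y"
      by (simp add: k_def)
    also have "\<dots> \<longleftrightarrow> - (r * x) \<le> y * s"
      by (rule pos_divide_le_eq[OF s])
    finally show ?thesis
      by (auto simp: mult.commute[of s])
  qed
  have "{p \<in> space (borel \<Otimes>\<^sub>M borel). 0 \<le> fst p \<and> k * fst p \<le> snd p} \<in> sets (borel \<Otimes>\<^sub>M (borel :: real measure))"
    by measurable
  then have "{(x, y). 0 \<le> x \<and> k * x \<le> y} \<in> sets (borel \<Otimes>\<^sub>M (borel :: real measure))"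
    by (simp add: space_pair_measure case_prod_beta')
  then have [measurable]: "{(x, y). 0 \<le> x \<and> k * x \<le> y} \<in> sets (?N \<Otimes>\<^sub>M ?N)"
    by (subst sets_pair_measure_cong[of _ borel _ borel]) simp_all
  have "emeasure (?N \<Otimes>\<^sub>M ?N) {(x, y). 0 \<le> x \<and> 0 \<le> r * x + s * y}
      = (\<integral>\<^sup>+x. \<integral>\<^sup>+y. indicator {(x, y). 0 \<le> x \<and> k * x \<le> y} (x, y) \<partial>?N \<partial>?N)"
    unfolding wedge by (rule N.emeasure_pair_measure) measurable
  also have "\<dots> = (\<integral>\<^sup>+x. ?\<phi> x * (\<integral>\<^sup>+y. indicator {(x, y). 0 \<le> x \<and> k * x \<le> y} (x, y) \<partial>?N) \<partial>lborel)"
    by (rule nn_integral_density; measurable)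
  also have "\<dots> = (\<integral>\<^sup>+x. ?\<phi> x * (\<integral>\<^sup>+y. indicator {0..} x * indicator {k * x..} y \<partial>?N) \<partial>lborel)"
    by (intro nn_integral_cong arg_cong2[where f="(*)"] refl) (auto split: split_indicator)
  also have "\<dots> = (\<integral>\<^sup>+x. ?\<phi> x * (indicator {0..} x * (\<integral>\<^sup>+y. ennreal (?\<phi> y) * indicator {k * x..} y \<partial>lborel)) \<partial>lborel)"
    by (intro nn_integral_cong) (simp add: nn_integral_cmult emeasure_density)
  also have "\<dots> = (\<integral>\<^sup>+x. \<integral>\<^sup>+t. ennreal (x * ?\<phi> x * ?\<phi> (x * t)) * indicator {0..} x * indicator {k..} t \<partial>lborel \<partial>lborel)"
  proof (rule nn_integral_cong_AE)
    \<comment> \<open>Equality fails at \<open>x = 0\<close>, where the left side is positive and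
      the right side vanishes, but a single point is a null set.\<close>
    show "AE x in lborel. ?\<phi> x * (indicator {0..} x * (\<integral>\<^sup>+y. ennreal (?\<phi> y) * indicator {k * x..} y \<partial>lborel)) =
        (\<integral>\<^sup>+t. ennreal (x * ?\<phi> x * ?\<phi> (x * t)) * indicator {0..} x * indicator {k..} t \<partial>lborel)"
      using AE_lborel_singleton[of "0::real"]
    proof eventually_elim
      fix x :: real
      assume "x \<noteq> 0"
      show "?\<phi> x * (indicator {0..} x * (\<integral>\<^sup>+y. ennreal (?\<phi> y) * indicator {k * x..} y \<partial>lborel)) =
        (\<integral>\<^sup>+t. ennreal (x * ?\<phi> x * ?\<phi> (x * t)) * indicator {0..} x * indicator {k..} t \<partial>lborel)"
      proof (cases "x > 0")
        case True
        \<comment> \<open>The substitution \<open>y = x t\<close> turns the wedge into a half plane in \<open>(x, t)\<close>.\<close>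
        have "(\<integral>\<^sup>+y. ennreal (?\<phi> y) * indicator {k * x..} y \<partial>lborel) =
            ennreal \<bar>x\<bar> * (\<integral>\<^sup>+t. ennreal (?\<phi> (0 + x * t)) * indicator {k * x..} (0 + x * t) \<partial>lborel)"
          using True by (intro nn_integral_real_affine) auto
        also have "\<dots> = ennreal x * (\<integral>\<^sup>+t. ennreal (?\<phi> (x * t)) * indicator {k..} t \<partial>lborel)"
          using True by (intro arg_cong2[where f="(*)"] nn_integral_cong)
            (auto simp: mult.commute split: split_indicator)
        finally show ?thesis
          using True by (simp add: nn_integral_cmult[symmetric] ennreal_mult mult_ac)
      qed (use \<open>x \<noteq> 0\<close> in auto)
    qed
  qed
  also have "\<dots> = (\<integral>\<^sup>+t. \<integral>\<^sup>+x. ennreal (x * ?\<phi> x * ?\<phi> (x * t)) * indicator {0..} x * indicator {k..} t \<partial>lborel \<partial>lborel)"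
    by (rule lborel_pair.Fubini') measurable
  also have "\<dots> = (\<integral>\<^sup>+t. ennreal (1 / (2 * pi) * inverse (1 + t\<^sup>2)) * indicator {k..} t \<partial>lborel)"
    by (simp add: nn_integral_multc nn_integral_std_normal_ray)
  also have "\<dots> = ennreal (1 / (2 * pi) * (pi / 2) - 1 / (2 * pi) * arctan k)"
  proof (rule nn_integral_FTC_atLeast)
    show "((\<lambda>t. 1 / (2 * pi) * arctan t) has_real_derivative 1 / (2 * pi) * inverse (1 + t\<^sup>2)) (at t)" for t :: real
      by (intro DERIV_cmult DERIV_arctan)
    show "((\<lambda>t. 1 / (2 * pi) * arctan t) \<longlongrightarrow> 1 / (2 * pi) * (pi / 2)) at_top"
      by (intro tendsto_mult_left tendsto_arctan_at_top)
  qed (auto simp: add_nonneg_nonneg)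
  finally show ?thesis
    by (simp add: k_def arctan_minus)
qed

text \<open>The wedge with \<open>r = 0\<close> and \<open>s = 1\<close> is a quadrant, so its
  probability 1/4 is the square of the one sought.\<close>

lemma std_normal_half_line: "measure std_normal_distribution {0..} = 1 / 2"
proof -
  let ?N = std_normal_distribution
  interpret N: prob_space ?N
    by (rule prob_space_normal_density) simp
  have "{(x, y). (0::real) \<le> x \<and> 0 \<le> 0 * x + 1 * y} = {0..} \<times> {0::real..}"
    by auto
  then have "ennreal (1 / 4) = emeasure ?N {0..} * emeasure ?N {0..}"
    using std_normal_pair_wedge[of 1 0] by (simp add: N.emeasure_pair_measure_Times)
  then have "measure ?N {0..} * measure ?N {0..} = 1 / 4"
    by (simp add: N.emeasure_eq_measure ennreal_mult[symmetric])
  then have "(measure ?N {0..})\<^sup>2 = (1 / 2)\<^sup>2"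
    by (simp add: power2_eq_square)
  then show ?thesis
    by (subst (asm) power2_eq_iff_nonneg) auto
qed

text \<open>The first marginal of the independence lemma, applied with the zero map as second
  component.\<close>

lemma distr_std_gaussian_inner:
  fixes u :: "real^'n::finite"
  shows "distr std_gaussian borel (\<lambda>w. u \<bullet> w) = distr std_normal_distribution borel (\<lambda>x. norm u * x)"
proof -
  interpret S: prob_space "std_gaussian :: (real^'n) measure"
    by (rule prob_space_std_gaussian)
  interpret N: prob_space "std_normal_distribution"
    by (rule prob_space_normal_density) simp
  let ?Z = "\<lambda>_ :: real^'n. 0 :: real"
  interpret Z: prob_space "distr std_gaussian borel ?Z"
    by (intro S.prob_space_distr) simp
  let ?U = "distr std_normal_distribution borel (\<lambda>x. norm u * x)"
  have "distr (distr std_gaussian borel (\<lambda>w. (u \<bullet> w, ?Z w))) borel fst = distr (?U \<Otimes>\<^sub>M distr std_gaussian borel ?Z) borel fst"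
    by (subst distr_std_gaussian_pair) (auto simp: linear_zero)
  also have "\<dots> = distr (?U \<Otimes>\<^sub>M distr std_gaussian borel ?Z) ?U fst"
    by (rule distr_cong) simp_all
  also have "\<dots> = ?U"
    by (rule Z.distr_pair_fst)
  finally show ?thesis
    by (subst (asm) distr_distr) (simp_all add: comp_def borel_prod[symmetric])
qed

text \<open>Gram-Schmidt writes \<open>w = r u + s v\<close> with \<open>v\<close> a unit vector
  orthogonal to \<open>u\<close>. Then \<open>u \<bullet> x\<close> and \<open>v \<bullet> x\<close>
  are independent standard normal, the event becomes the planar wedge, and
  \<open>arctan (r / s) = arcsin r\<close>. For \<open>r = 1\<close> there is no \<open>v\<close>,
  and the event is a half space.\<close>

lemma std_gaussian_orthant:
  fixes u w :: "real^'n::finite"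
  assumes u: "norm u = 1" and w: "norm w = 1" and r: "u \<bullet> w > -1"
  shows "measure std_gaussian {x. 0 \<le> u \<bullet> x \<and> 0 \<le> w \<bullet> x} = 1 / 4 + arcsin (u \<bullet> w) / (2 * pi)"
proof -
  let ?N = std_normal_distribution
  let ?r = "u \<bullet> w"
  have uu: "u \<bullet> u = 1" and ww: "w \<bullet> w = 1"
    using u w by (simp_all add: norm_eq_1)
  have "?r \<le> 1"
    using norm_cauchy_schwarz[of u w] u w by simp
  then consider "?r = 1" | "?r < 1"
    by linarith
  then show ?thesis
  proof cases
    case 1
    then have "w = u"
      using norm_cauchy_schwarz_eq[of u w] u w by simp
    have "measure std_gaussian {x. 0 \<le> u \<bullet> x} = measure (distr std_gaussian borel (\<lambda>x. u \<bullet> x)) {0..}"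
      by (subst measure_distr) (auto intro!: arg_cong[where f="measure _"] simp: std_gaussian_def)
    then show ?thesis
      by (simp add: \<open>w = u\<close> uu distr_std_gaussian_inner u distr_id2 std_normal_half_line)
  next
    case 2
    define s where "s = sqrt (1 - ?r\<^sup>2)"
    have r2: "?r\<^sup>2 < 1"
      using 2 r by (simp add: abs_square_less_1)
    then have s: "s > 0" "s\<^sup>2 = 1 - ?r\<^sup>2"
      by (simp_all add: s_def)
    define v where "v = (w - ?r *\<^sub>R u) /\<^sub>R s"
    have wv: "w = ?r *\<^sub>R u + s *\<^sub>R v"
      using s by (simp add: v_def)
    have "v \<bullet> u = inverse s * (w \<bullet> u - ?r * (u \<bullet> u))"
      by (simp add: v_def inner_diff_left)
    then have vu: "v \<bullet> u = 0"
      by (simp add: uu inner_commute[of w u])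
    have "(w - ?r *\<^sub>R u) \<bullet> (w - ?r *\<^sub>R u) = 1 - ?r\<^sup>2"
      by (simp add: inner_diff_left inner_diff_right uu ww power2_eq_square inner_commute[of w u])
    then have "v \<bullet> v = inverse s * (inverse s * s\<^sup>2)"
      by (simp add: v_def s(2))
    then have nv: "norm v = 1"
      using s(1) by (simp add: norm_eq_1 power2_eq_square field_simps)
    have wx: "?r * (u \<bullet> x) + s * (v \<bullet> x) = w \<bullet> x" for x
      using arg_cong[OF wv, of "\<lambda>z. z \<bullet> x"] by (simp add: inner_add_left)
    let ?W = "{(x, y). 0 \<le> x \<and> 0 \<le> ?r * x + s * y}"
    have "{p \<in> space (borel \<Otimes>\<^sub>M borel). 0 \<le> fst p \<and> 0 \<le> ?r * fst p + s * snd p} \<in> sets (borel \<Otimes>\<^sub>M (borel :: real measure))"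
      by measurable
    then have W: "?W \<in> sets (borel \<Otimes>\<^sub>M (borel :: real measure))"
      by (simp add: space_pair_measure case_prod_beta')
    have "(*) (1 :: real) = (\<lambda>x. x)"
      by auto
    then have "distr std_gaussian borel (\<lambda>x. (u \<bullet> x, v \<bullet> x)) = ?N \<Otimes>\<^sub>M ?N"
      by (subst distr_std_gaussian_pair)
        (auto simp: vu distr_std_gaussian_inner u nv distr_id2 bounded_linear.linear bounded_linear_inner_right)
    then have "emeasure (?N \<Otimes>\<^sub>M ?N) ?W = emeasure (distr std_gaussian borel (\<lambda>x. (u \<bullet> x, v \<bullet> x))) ?W"
      by simp
    also have "\<dots> = emeasure std_gaussian {x. 0 \<le> u \<bullet> x \<and> 0 \<le> ?r * (u \<bullet> x) + s * (v \<bullet> x)}"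
      using W[unfolded borel_prod] by (subst emeasure_distr) (auto intro!: arg_cong[where f="emeasure _"] simp: std_gaussian_def borel_prod)
    finally have "emeasure std_gaussian {x. 0 \<le> u \<bullet> x \<and> 0 \<le> w \<bullet> x} = ennreal (1 / 4 + arctan (?r / s) / (2 * pi))"
      by (simp add: wx std_normal_pair_wedge s)
    moreover have "arctan (?r / s) = arcsin ?r"
      using 2 r by (simp add: arcsin_arctan s_def)
    moreover have "1 / 4 + arcsin ?r / (2 * pi) \<ge> 0"
      using arcsin_lbound[of ?r] 2 r by (simp add: field_simps)
    ultimately show ?thesis
      by (simp add: measure_def)
  qed
qed

section \<open>Integrated squares of normal tails\<close>

text \<open>The upper tail of \<open>N(0, \<eta>^2)\<close>. Multiplying by \<open>\<eta>\<close>
  instead of dividing includes the degenerate case \<open>\<eta> = 0\<close>, where it is the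
  indicator of \<open>t \<le> 0\<close>.\<close>

definition normal_tail :: "real \<Rightarrow> real \<Rightarrow> real" where
  "normal_tail \<eta> t = measure std_normal_distribution {x. t \<le> \<eta> * x}"

lemma normal_tail_eq_integral: "normal_tail \<eta> t = (\<integral>x. indicator {z. t \<le> \<eta> * z} x \<partial>std_normal_distribution)"
  by (simp add: normal_tail_def)

lemma borel_measurable_normal_tail [measurable]: "normal_tail \<eta> \<in> borel_measurable borel"
proof -
  interpret N: prob_space "std_normal_distribution"
    by (rule prob_space_normal_density) simp
  have "(\<lambda>t. \<integral>x. (if t \<le> \<eta> * x then 1 else 0 :: real) \<partial>std_normal_distribution) \<in> borel_measurable borel"
    by measurable
  moreover have "normal_tail \<eta> t = (\<integral>x. (if t \<le> \<eta> * x then 1 else 0 :: real) \<partial>std_normal_distribution)" for t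
    unfolding normal_tail_eq_integral by (intro Bochner_Integration.integral_cong) (auto split: split_indicator)
  ultimately show ?thesis
    by (simp add: fun_eq_iff[symmetric] cong: measurable_cong)
qed

lemma normal_tail_bounds: "0 \<le> normal_tail \<eta> t" "normal_tail \<eta> t \<le> 1"
proof -
  interpret N: prob_space "std_normal_distribution"
    by (rule prob_space_normal_density) simp
  show "0 \<le> normal_tail \<eta> t" "normal_tail \<eta> t \<le> 1"
    by (simp_all add: normal_tail_def)
qed

text \<open>Gathers four independent normal variables into one Gaussian vector, to which the orthant
  formula applies. The coordinates are split off one at a time, each axis vector being killed by the
  later coordinates.\<close>

lemma distr_std_gaussian_axis4:
  "distr (std_gaussian :: (real^4) measure) borel (\<lambda>w. (w $ 1, w $ 2, w $ 3, w $ 4)) =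
    std_normal_distribution \<Otimes>\<^sub>M (std_normal_distribution \<Otimes>\<^sub>M (std_normal_distribution \<Otimes>\<^sub>M std_normal_distribution))"
proof -
  have one: "(*) (1 :: real) = (\<lambda>x. x)"
    by auto
  have ax: "w $ i = axis i 1 \<bullet> w" for w :: "real^4" and i
    by (simp add: inner_axis')
  have az: "axis i (1 :: real) $ j = (if j = i then 1 else 0)" for i j :: 4
    by (simp add: axis_def)
  have nz: "(1::4) \<noteq> 2" "(1::4) \<noteq> 3" "(1::4) \<noteq> 4" "(2::4) \<noteq> 3" "(2::4) \<noteq> 4" "(3::4) \<noteq> 4"
    by simp_all
  have 4: "distr (std_gaussian :: (real^4) measure) borel (\<lambda>w. w $ 4) = std_normal_distribution"
    unfolding ax by (simp add: distr_std_gaussian_inner one distr_id2)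
  have 3: "distr (std_gaussian :: (real^4) measure) borel (\<lambda>w. (w $ 3, w $ 4)) =
      std_normal_distribution \<Otimes>\<^sub>M std_normal_distribution"
    unfolding ax[of _ 3] using nz
    by (subst distr_std_gaussian_pair) (auto simp: 4 one distr_id2 az intro!: linearI)
  have 2: "distr (std_gaussian :: (real^4) measure) borel (\<lambda>w. (w $ 2, w $ 3, w $ 4)) =
      std_normal_distribution \<Otimes>\<^sub>M (std_normal_distribution \<Otimes>\<^sub>M std_normal_distribution)"
    unfolding ax[of _ 2] using nz
    by (subst distr_std_gaussian_pair) (auto simp: 3 one distr_id2 az zero_prod_def intro!: linearI)
  show ?thesis
    unfolding ax[of _ 1] using nz
    by (subst distr_std_gaussian_pair) (auto simp: 2 one distr_id2 az zero_prod_def intro!: linearI)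
qed

text \<open>Squaring introduces two independent noises \<open>a\<close> and \<open>b\<close>. The
  integral is therefore the probability that \<open>\<tau> * v + \<eta> * a\<close> and
  \<open>\<tau> * v + \<eta> * b\<close> both reach \<open>\<sigma> * y\<close>, an intersection of
  two half spaces in four dimensions.\<close>

lemma integral_normal_tail_square:
  assumes s: "\<sigma> > 0" and te: "\<tau>\<^sup>2 + \<eta>\<^sup>2 = \<sigma>\<^sup>2"
  shows "(LINT y|std_normal_distribution. LINT v|std_normal_distribution. (normal_tail \<eta> (\<sigma> * y - \<tau> * v))\<^sup>2)
    = 1 / 4 + arcsin ((1 + \<tau>\<^sup>2 / \<sigma>\<^sup>2) / 2) / (2 * pi)"
proof -
  let ?N = std_normal_distribution
  interpret N: prob_space ?N
    by (rule prob_space_normal_density) simp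
  interpret N2: pair_prob_space ?N ?N ..
  interpret N3: pair_prob_space ?N "?N \<Otimes>\<^sub>M ?N" ..
  interpret N4: pair_prob_space ?N "?N \<Otimes>\<^sub>M (?N \<Otimes>\<^sub>M ?N)" ..
  define W where "W = {(y, v, a, b). \<sigma> * y - \<tau> * v \<le> \<eta> * a \<and> \<sigma> * y - \<tau> * v \<le> \<eta> * b}"
  have "{p \<in> space (borel \<Otimes>\<^sub>M (borel \<Otimes>\<^sub>M (borel \<Otimes>\<^sub>M borel))). \<sigma> * fst p - \<tau> * fst (snd p) \<le> \<eta> * fst (snd (snd p)) \<and>
      \<sigma> * fst p - \<tau> * fst (snd p) \<le> \<eta> * snd (snd (snd p))} \<in> sets (borel \<Otimes>\<^sub>M (borel \<Otimes>\<^sub>M (borel \<Otimes>\<^sub>M (borel :: real measure))))"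
    by measurable
  then have WB: "W \<in> sets (borel \<Otimes>\<^sub>M (borel \<Otimes>\<^sub>M (borel \<Otimes>\<^sub>M borel)))"
    by (simp add: W_def space_pair_measure case_prod_beta')
  have "sets (?N \<Otimes>\<^sub>M (?N \<Otimes>\<^sub>M (?N \<Otimes>\<^sub>M ?N))) = sets (borel \<Otimes>\<^sub>M (borel \<Otimes>\<^sub>M (borel \<Otimes>\<^sub>M borel)))"
    by (intro sets_pair_measure_cong) simp_all
  with WB have [measurable]: "W \<in> sets (?N \<Otimes>\<^sub>M (?N \<Otimes>\<^sub>M (?N \<Otimes>\<^sub>M ?N)))"
    by blast
  have sq: "(normal_tail \<eta> (\<sigma> * y - \<tau> * v))\<^sup>2 = (LINT p|(?N \<Otimes>\<^sub>M ?N). indicator W (y, v, p))" for y v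
  proof -
    let ?T = "{x. \<sigma> * y - \<tau> * v \<le> \<eta> * x}"
    have "(LINT p|(?N \<Otimes>\<^sub>M ?N). indicator W (y, v, p)) = (LINT p|(?N \<Otimes>\<^sub>M ?N). indicator (?T \<times> ?T) p)"
      by (intro Bochner_Integration.integral_cong) (auto simp: W_def split: split_indicator)
    also have "\<dots> = measure (?N \<Otimes>\<^sub>M ?N) (?T \<times> ?T)"
      by (simp add: space_pair_measure)
    also have "\<dots> = measure ?N ?T * measure ?N ?T"
      by (simp add: measure_def N.emeasure_pair_measure_Times enn2real_mult)
    finally show ?thesis
      by (simp add: normal_tail_def power2_eq_square)
  qed
  have inner: "(LINT v|?N. LINT p|(?N \<Otimes>\<^sub>M ?N). indicator W (y, v, p)) = (LINT p|(?N \<Otimes>\<^sub>M (?N \<Otimes>\<^sub>M ?N)). indicator W (y, p) :: real)" for y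
    by (intro N3.integral_fst'[of "\<lambda>p. indicator W (y, p)"] N3.P.integrable_const_bound[where B=1]) (auto split: split_indicator)
  have "(LINT y|?N. LINT v|?N. (normal_tail \<eta> (\<sigma> * y - \<tau> * v))\<^sup>2)
      = (LINT y|?N. LINT p|(?N \<Otimes>\<^sub>M (?N \<Otimes>\<^sub>M ?N)). indicator W (y, p))"
    by (simp only: sq inner)
  also have "\<dots> = (LINT p|(?N \<Otimes>\<^sub>M (?N \<Otimes>\<^sub>M (?N \<Otimes>\<^sub>M ?N))). indicator W p)"
    by (intro N4.integral_fst' N4.P.integrable_const_bound[where B=1]) (auto split: split_indicator)
  also have "\<dots> = measure (?N \<Otimes>\<^sub>M (?N \<Otimes>\<^sub>M (?N \<Otimes>\<^sub>M ?N))) W"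
    by (simp add: space_pair_measure)
  also have "\<dots> = measure (std_gaussian :: (real^4) measure) {w. (w $ 1, w $ 2, w $ 3, w $ 4) \<in> W}"
    unfolding distr_std_gaussian_axis4[symmetric]
    using WB[unfolded borel_prod] by (subst measure_distr) (auto intro!: arg_cong[where f="measure _"] simp: std_gaussian_def borel_prod)
  also have "\<dots> = 1 / 4 + arcsin ((1 + \<tau>\<^sup>2 / \<sigma>\<^sup>2) / 2) / (2 * pi)"
  proof -
    \<comment> \<open>\<open>p\<close> and \<open>q\<close> are the normals of the two half spaces.
      Unscaled, their squared length is
      \<open>\<sigma>^2 + \<tau>^2 + \<eta>^2 = 2 * \<sigma>^2\<close>, so \<open>c\<close> makes
      them unit vectors. They share the entries for \<open>y\<close> and \<open>v\<close>, which
      yields the inner product \<open>c^2 * (\<sigma>^2 + \<tau>^2)\<close>.\<close>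
    define c where "c = 1 / (sqrt 2 * \<sigma>)"
    define p :: "real^4" where "p = c *\<^sub>R (\<chi> i. if i = 1 then - \<sigma> else if i = 2 then \<tau> else if i = 3 then \<eta> else 0)"
    define q :: "real^4" where "q = c *\<^sub>R (\<chi> i. if i = 1 then - \<sigma> else if i = 2 then \<tau> else if i = 4 then \<eta> else 0)"
    have c: "c > 0" "c * c = 1 / (2 * \<sigma>\<^sup>2)"
      using s by (simp_all add: c_def power2_eq_square)
    have p: "p \<bullet> w = c * (- \<sigma> * w $ 1 + \<tau> * w $ 2 + \<eta> * w $ 3)"
      and q: "q \<bullet> w = c * (- \<sigma> * w $ 1 + \<tau> * w $ 2 + \<eta> * w $ 4)" for w
      by (simp_all add: p_def q_def inner_vec_def sum_4 algebra_simps)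
    have pp: "p \<bullet> p = c * c * (\<sigma>\<^sup>2 + \<tau>\<^sup>2 + \<eta>\<^sup>2)" and qq: "q \<bullet> q = c * c * (\<sigma>\<^sup>2 + \<tau>\<^sup>2 + \<eta>\<^sup>2)"
      and pq: "p \<bullet> q = c * c * (\<sigma>\<^sup>2 + \<tau>\<^sup>2)"
      unfolding p q by (simp_all add: p_def q_def power2_eq_square algebra_simps)
    have "p \<bullet> p = 1" "q \<bullet> q = 1"
      using s unfolding pp qq c by (simp_all add: add.assoc te)
    then have n: "norm p = 1" "norm q = 1"
      by (simp_all add: norm_eq_1)
    have r: "p \<bullet> q = (1 + \<tau>\<^sup>2 / \<sigma>\<^sup>2) / 2"
      using s unfolding pq c by (simp add: field_simps)
    have "(1 + \<tau>\<^sup>2 / \<sigma>\<^sup>2) / 2 > -1"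
      by (rule less_le_trans[of _ 0]) auto
    moreover have "{w. (w $ 1, w $ 2, w $ 3, w $ 4) \<in> W} = {w. 0 \<le> p \<bullet> w \<and> 0 \<le> q \<bullet> w}"
      unfolding p q using c(1) by (auto simp: W_def zero_le_mult_iff)
    ultimately show ?thesis
      using std_gaussian_orthant[OF n, unfolded r] by simp
  qed
  finally show ?thesis .
qed

section \<open>Conditional probabilities and the value of \<open>xi\<close> in a Gaussian
  regression\<close>

text \<open>Since the residual is independent of \<open>X\<close>, integrating it out with
  \<open>X\<close> held fixed produces the tail. Fubini for the product law then verifies the
  defining identity of conditional expectation on every preimage of a Borel set under
  \<open>X\<close>.\<close>

lemma cond_prob_given_independent_noise:
  fixes X :: "'a \<Rightarrow> real^'p::finite"
  assumes M: "prob_space M"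
    and X [measurable]: "X \<in> borel_measurable M" and Y [measurable]: "Y \<in> borel_measurable M"
    and law: "distr M borel (\<lambda>\<omega>. (Y \<omega> - \<beta> \<bullet> X \<omega>, X \<omega>)) =
      distr std_normal_distribution borel (\<lambda>x. \<eta> * x) \<Otimes>\<^sub>M distr M borel X"
  shows "AE \<omega> in M. cond_prob_given M X {\<omega> \<in> space M. y \<le> Y \<omega>} \<omega> = normal_tail \<eta> (y - \<beta> \<bullet> X \<omega>)"
proof -
  let ?N = std_normal_distribution
  let ?F = "vimage_algebra (space M) X borel"
  let ?E = "distr ?N borel (\<lambda>x. \<eta> * x)"
  interpret M: prob_space M by fact
  interpret N: prob_space ?N
    by (rule prob_space_normal_density) simp
  interpret E: prob_space ?E
    by (intro N.prob_space_distr) simp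
  interpret DX: prob_space "distr M borel X"
    by (intro M.prob_space_distr) simp
  interpret EX: pair_prob_space ?E "distr M borel X" ..
  have sub: "subalgebra M ?F"
    unfolding subalgebra_def by (auto simp: sets_vimage_algebra2 measurable_sets)
  interpret finite_measure_subalgebra M ?F
    by standard (rule sub)
  show ?thesis
    unfolding cond_prob_given_def
  proof (rule real_cond_exp_charact)
    show "(\<lambda>\<omega>. normal_tail \<eta> (y - \<beta> \<bullet> X \<omega>)) \<in> borel_measurable ?F"
    proof -
      have "X \<in> measurable ?F borel"
        by (rule measurable_vimage_algebra1) simp
      then show ?thesis
        by measurable
    qed
    show "integrable M (indicator {\<omega> \<in> space M. y \<le> Y \<omega>} :: 'a \<Rightarrow> real)"
      by (rule M.integrable_const_bound[where B=1]) auto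
    show "integrable M (\<lambda>\<omega>. normal_tail \<eta> (y - \<beta> \<bullet> X \<omega>))"
      by (rule M.integrable_const_bound[where B=1]) (auto simp: normal_tail_bounds)
    fix A assume "A \<in> sets ?F"
    then obtain B where B [measurable]: "B \<in> sets borel" and A: "A = X -` B \<inter> space M"
      by (auto simp: sets_vimage_algebra2)
    \<comment> \<open>With \<open>e\<close> standing for the residual, \<open>y \<le> Y\<close>
      reads \<open>y - \<beta> \<bullet> x \<le> e\<close>, so the integrand is a function of the
      independent pair alone.\<close>
    define h :: "real \<Rightarrow> real^'p \<Rightarrow> real" where "h e x = (if y - \<beta> \<bullet> x \<le> e then indicator B x else 0)" for e x
    have hm: "case_prod h \<in> borel_measurable borel"
      unfolding h_def case_prod_beta' borel_prod[symmetric] by measurable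
    then have hm': "case_prod h \<in> borel_measurable (?E \<Otimes>\<^sub>M distr M borel X)"
      unfolding borel_prod[symmetric] by (simp cong: measurable_cong_sets add: measurable_def sets_pair_measure_cong[of ?E borel "distr M borel X" borel] space_pair_measure)
    have tail: "(\<integral>e. h e x \<partial>?E) = indicator B x * normal_tail \<eta> (y - \<beta> \<bullet> x)" for x
    proof -
      have "(\<integral>e. h e x \<partial>?E) = (\<integral>z. h (\<eta> * z) x \<partial>?N)"
        unfolding h_def by (subst integral_distr) auto
      also have "\<dots> = (\<integral>z. indicator B x * indicator {z. y - \<beta> \<bullet> x \<le> \<eta> * z} z \<partial>?N)"
        by (intro Bochner_Integration.integral_cong) (auto simp: h_def)
      finally show ?thesis
        by (simp add: normal_tail_def)
    qed
    have "(\<integral>\<omega>\<in>A. indicator {\<omega> \<in> space M. y \<le> Y \<omega>} \<omega> \<partial>M) = (\<integral>\<omega>. h (Y \<omega> - \<beta> \<bullet> X \<omega>) (X \<omega>) \<partial>M)"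
      unfolding set_lebesgue_integral_def
      by (intro Bochner_Integration.integral_cong) (auto simp: h_def A split: split_indicator)
    also have "\<dots> = (\<integral>p. case_prod h p \<partial>distr M borel (\<lambda>\<omega>. (Y \<omega> - \<beta> \<bullet> X \<omega>, X \<omega>)))"
      using hm by (subst integral_distr) auto
    also have "\<dots> = (\<integral>x. \<integral>e. h e x \<partial>?E \<partial>distr M borel X)"
      unfolding law using hm'
      by (intro EX.integral_snd[symmetric] EX.P.integrable_const_bound[where B=1])
        (auto simp: h_def split: split_indicator)
    also have "\<dots> = (\<integral>\<omega>\<in>A. normal_tail \<eta> (y - \<beta> \<bullet> X \<omega>) \<partial>M)"
      unfolding set_lebesgue_integral_def tail
      by (subst integral_distr) (auto intro!: Bochner_Integration.integral_cong simp: A split: split_indicator)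
    finally show "(\<integral>\<omega>\<in>A. indicator {\<omega> \<in> space M. y \<le> Y \<omega>} \<omega> \<partial>M) = (\<integral>\<omega>\<in>A. normal_tail \<eta> (y - \<beta> \<bullet> X \<omega>) \<partial>M)" .
  qed
qed

text \<open>Each variance is a second moment minus a squared mean, and both means equal
  \<open>normal_tail \<sigma> y\<close>. All remaining integrals are instances of \<open>?K\<close>:
  the numerator is \<open>?K \<tau> \<eta> - 1 / 3\<close> and the denominator
  \<open>1 / 2 - 1 / 3\<close>.\<close>

lemma xi_gaussian_regression:
  fixes X :: "'a \<Rightarrow> real^'p::finite"
  assumes M: "prob_space M"
    and X [measurable]: "X \<in> borel_measurable M" and Y [measurable]: "Y \<in> borel_measurable M"
    and law: "distr M borel (\<lambda>\<omega>. (Y \<omega> - \<beta> \<bullet> X \<omega>, X \<omega>)) =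
      distr std_normal_distribution borel (\<lambda>x. \<eta> * x) \<Otimes>\<^sub>M distr M borel X"
    and lawV: "distr M borel (\<lambda>\<omega>. \<beta> \<bullet> X \<omega>) = distr std_normal_distribution borel (\<lambda>x. \<tau> * x)"
    and lawY: "distr M borel Y = distr std_normal_distribution borel (\<lambda>x. \<sigma> * x)"
    and s: "\<sigma> > 0" and te: "\<tau>\<^sup>2 + \<eta>\<^sup>2 = \<sigma>\<^sup>2"
  shows "xi M Y X = 3 / pi * arcsin ((1 + \<tau>\<^sup>2 / \<sigma>\<^sup>2) / 2) - 1 / 2"
proof -
  let ?N = std_normal_distribution
  let ?K = "\<lambda>\<tau> \<eta>. LINT y|?N. LINT v|?N. (normal_tail \<eta> (\<sigma> * y - \<tau> * v))\<^sup>2"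
  interpret M: prob_space M by fact
  interpret N: prob_space ?N
    by (rule prob_space_normal_density) simp
  interpret NN: pair_prob_space ?N ?N ..
  let ?F = "vimage_algebra (space M) X borel"
  have sub: "subalgebra M ?F"
    unfolding subalgebra_def by (auto simp: sets_vimage_algebra2 measurable_sets)
  interpret finite_measure_subalgebra M ?F
    by standard (rule sub)
  have int_ind: "integrable M (indicator {\<omega> \<in> space M. y \<le> Y \<omega>} :: 'a \<Rightarrow> real)" for y
    by (rule M.integrable_const_bound[where B=1]) auto
  have prob: "M.prob {\<omega> \<in> space M. y \<le> Y \<omega>} = normal_tail \<sigma> y" for y
  proof -
    have "M.prob {\<omega> \<in> space M. y \<le> Y \<omega>} = measure (distr M borel Y) {y..}"
      by (subst measure_distr) (auto intro!: arg_cong[where f=M.prob])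
    also have "\<dots> = normal_tail \<sigma> y"
      unfolding lawY normal_tail_def by (subst measure_distr) (auto intro!: arg_cong[where f="measure _"])
    finally show ?thesis .
  qed
  have int_sq: "integrable ?N (\<lambda>y. (normal_tail \<sigma> (\<sigma> * y))\<^sup>2)" "integrable ?N (\<lambda>y. normal_tail \<sigma> (\<sigma> * y))"
    using normal_tail_bounds by (auto intro!: N.integrable_const_bound[where B=1] simp: abs_square_le_1)
  have int_K: "integrable ?N (\<lambda>y. LINT v|?N. (normal_tail \<eta> (\<sigma> * y - \<tau> * v))\<^sup>2)"
  proof -
    have "integrable (?N \<Otimes>\<^sub>M ?N) (\<lambda>p. (normal_tail \<eta> (\<sigma> * fst p - \<tau> * snd p))\<^sup>2)"
      using normal_tail_bounds by (auto intro!: NN.P.integrable_const_bound[where B=1] simp: abs_square_le_1)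
    from NN.integrable_fst'[OF this] show ?thesis
      by simp
  qed
  have var_ind: "M.variance (indicator {\<omega> \<in> space M. y \<le> Y \<omega>}) = normal_tail \<sigma> y - (normal_tail \<sigma> y)\<^sup>2" for y
  proof -
    have sq: "(indicator S \<omega> :: real)\<^sup>2 = indicator S \<omega>" for S and \<omega> :: 'a
      by (simp split: split_indicator)
    show ?thesis
      by (subst M.variance_eq) (simp_all add: sq prob int_ind)
  qed
  have var_cond: "M.variance (cond_prob_given M X {\<omega> \<in> space M. y \<le> Y \<omega>}) =
      (LINT v|?N. (normal_tail \<eta> (y - \<tau> * v))\<^sup>2) - (normal_tail \<sigma> y)\<^sup>2" for y
  proof -
    let ?C = "cond_prob_given M X {\<omega> \<in> space M. y \<le> Y \<omega>}"
    have ae: "AE \<omega> in M. ?C \<omega> = normal_tail \<eta> (y - \<beta> \<bullet> X \<omega>)"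
      by (rule cond_prob_given_independent_noise[OF M X Y law])
    have Cm [measurable]: "?C \<in> borel_measurable M"
      unfolding cond_prob_given_def by simp
    have EC: "M.expectation ?C = normal_tail \<sigma> y"
      unfolding cond_prob_given_def by (subst real_cond_exp_int(2)) (simp_all add: prob int_ind)
    \<comment> \<open>The conditional probability is an arbitrary version, so its bounds, and with
      them integrability, come almost everywhere from the explicit tail.\<close>
    have ae01: "AE \<omega> in M. 0 \<le> ?C \<omega> \<and> ?C \<omega> \<le> 1"
      using ae by eventually_elim (simp add: normal_tail_bounds)
    have "AE \<omega> in M. norm (?C \<omega>) \<le> 1" "AE \<omega> in M. norm ((?C \<omega>)\<^sup>2) \<le> 1"
      using ae01 by (eventually_elim, simp add: abs_square_le_1)+
    then have "integrable M ?C" "integrable M (\<lambda>\<omega>. (?C \<omega>)\<^sup>2)"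
      by (auto intro: M.integrable_const_bound[where B=1])
    then have "M.variance ?C = (\<integral>\<omega>. (?C \<omega>)\<^sup>2 \<partial>M) - (normal_tail \<sigma> y)\<^sup>2"
      by (subst M.variance_eq) (simp_all add: EC)
    also have "(\<integral>\<omega>. (?C \<omega>)\<^sup>2 \<partial>M) = (\<integral>\<omega>. (normal_tail \<eta> (y - \<beta> \<bullet> X \<omega>))\<^sup>2 \<partial>M)"
      using ae by (intro integral_cong_AE) (auto elim!: eventually_mono)
    also have "\<dots> = (\<integral>v. (normal_tail \<eta> (y - v))\<^sup>2 \<partial>distr M borel (\<lambda>\<omega>. \<beta> \<bullet> X \<omega>))"
      by (subst integral_distr) auto
    also have "\<dots> = (LINT v|?N. (normal_tail \<eta> (y - \<tau> * v))\<^sup>2)"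
      unfolding lawV by (subst integral_distr) auto
    finally show ?thesis .
  qed
  \<comment> \<open>With \<open>\<tau> = 0\<close> and \<open>\<eta> = \<sigma>\<close> the
    integrand of \<open>?K\<close> does not depend on \<open>v\<close>, and the formula gives
    \<open>1 / 4 + 1 / 12\<close>.\<close>
  have third: "(LINT y|?N. (normal_tail \<sigma> (\<sigma> * y))\<^sup>2) = 1 / 3"
  proof -
    have "?K 0 \<sigma> = 1 / 4 + arcsin (1 / 2) / (2 * pi)"
      using integral_normal_tail_square[OF s, of 0 \<sigma>] by simp
    moreover have "arcsin (1 / 2) = pi / 6"
      using arcsin_sin[of "pi / 6"] by (simp add: sin_30)
    ultimately show ?thesis
      by (simp add: N.prob_space[simplified])
  qed
  \<comment> \<open>With \<open>\<tau> = \<sigma>\<close> and \<open>\<eta> = 0\<close> the tail is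
    an indicator, hence its own square, and integrating over \<open>v\<close> restores
    \<open>normal_tail \<sigma>\<close>. The formula gives \<open>1 / 4 + 1 / 4\<close>.\<close>
  have half: "(LINT y|?N. normal_tail \<sigma> (\<sigma> * y)) = 1 / 2"
  proof -
    have "(LINT v|?N. (normal_tail 0 (\<sigma> * y - \<sigma> * v))\<^sup>2) = normal_tail \<sigma> (\<sigma> * y)" for y
    proof -
      have "normal_tail 0 (\<sigma> * y - \<sigma> * v) = indicator {v. \<sigma> * y \<le> \<sigma> * v} v" for v
        by (simp add: normal_tail_def N.prob_space[simplified] split: split_indicator)
      then have "(normal_tail 0 (\<sigma> * y - \<sigma> * v))\<^sup>2 = indicator {v. \<sigma> * y \<le> \<sigma> * v} v" for v
        by (simp split: split_indicator)
      then show ?thesis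
        by (simp add: normal_tail_def)
    qed
    then show ?thesis
      using integral_normal_tail_square[OF s, of \<sigma> 0] s by simp
  qed
  have num: "(LINT y|distr M borel Y. M.variance (cond_prob_given M X {\<omega> \<in> space M. Y \<omega> \<ge> y})) = ?K \<tau> \<eta> - 1 / 3"
  proof -
    have "(\<lambda>y. LINT v|?N. (normal_tail \<eta> (y - \<tau> * v))\<^sup>2) \<in> borel_measurable borel"
      by measurable
    then show ?thesis
      unfolding lawY var_cond by (subst integral_distr) (auto simp: int_sq int_K third)
  qed
  have den: "(LINT y|distr M borel Y. M.variance (indicator {\<omega> \<in> space M. Y \<omega> \<ge> y})) = (1 / 6 :: real)"
    unfolding lawY var_ind by (subst integral_distr) (auto simp: int_sq half third)
  have "xi M Y X = (?K \<tau> \<eta> - 1 / 3) / (1 / 6)"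
    by (simp only: xi_def num den)
  then show ?thesis
    unfolding integral_normal_tail_square[OF s te] by (simp add: algebra_simps)
qed

section \<open>Generalized inverses and possibly singular covariance matrices\<close>

lemma matrix_diff_rdistrib:
  fixes A B :: "'a::ring_1^'n::finite^'m::finite"
  shows "(A - B) ** C = A ** C - B ** C"
  by (simp add: vec_eq_iff matrix_matrix_mult_def sum_subtractf left_diff_distrib)

text \<open>The defect \<open>R = ?P ** B - B\<close> satisfies \<open>R ** transpose B = 0\<close>,
  and it is itself a multiple of \<open>B\<close> from the left. Hence
  \<open>R ** transpose R = 0\<close>, and the diagonal of that product holds the squared row
  lengths of \<open>R\<close>. So \<open>?P\<close> fixes the column space of \<open>B\<close> for
  every choice of \<open>G\<close>.\<close>

lemma generalized_inverse_Gram: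
  fixes B :: "real^'m::finite^'n::finite"
  assumes "generalized_inverse (B ** transpose B) G"
  shows "B ** transpose B ** G ** B = B"
proof -
  let ?P = "B ** transpose B ** G"
  define R where "R = ?P ** B - B"
  have "R ** transpose B = ?P ** (B ** transpose B) - B ** transpose B"
    by (simp only: R_def matrix_diff_rdistrib matrix_mul_assoc)
  then have RB: "R ** transpose B = 0"
    using assms by (simp add: generalized_inverse_def)
  have "R = (?P - mat 1) ** B"
    by (simp add: R_def matrix_diff_rdistrib)
  then have "transpose R = transpose B ** transpose (?P - mat 1)"
    by (simp add: matrix_transpose_mul)
  then have "R ** transpose R = 0"
    using RB by (simp add: matrix_mul_assoc)
  moreover have "(R ** transpose R) $ i $ i = R $ i \<bullet> R $ i" for i
    by (simp add: matrix_matrix_mult_def transpose_def inner_vec_def)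
  ultimately have "R $ i \<bullet> R $ i = 0" for i
    by (metis zero_index)
  then have "R $ i = 0" for i
    by simp
  then have "R = 0"
    by (simp add: vec_eq_iff)
  then show ?thesis
    by (simp add: R_def)
qed

theorem proposition2p7:
  fixes M :: "'a measure"
    and X :: "'a \<Rightarrow> real^'p::finite"
    and Y :: "'a \<Rightarrow> real"
    and S11 G :: "real^'p^'p"
    and S12 S21 :: "real^'p"
    and \<sigma>Y :: real
  assumes "prob_space M"
    and "multivariate_normal M (\<lambda>\<omega>. append_scalar (X \<omega>) (Y \<omega>)) 0
           (bordered_matrix S11 S12 S21 (\<sigma>Y\<^sup>2))"
    and "\<sigma>Y > 0"
    and "generalized_inverse S11 G"
  shows "let \<rho> = sqrt (S21 \<bullet> (G *v S12) / \<sigma>Y\<^sup>2) in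
           xi M Y X = 3 / pi * arcsin ((1 + \<rho>\<^sup>2) / 2) - 1 / 2"
proof -
  define Z where "Z \<omega> = append_scalar (X \<omega>) (Y \<omega>)" for \<omega>
  obtain A :: "real^('p + unit)^('p + unit)" where Z [measurable]: "Z \<in> borel_measurable M"
    and A: "A ** transpose A = bordered_matrix S11 S12 S21 (\<sigma>Y\<^sup>2)"
    and lawZ: "distr M borel Z = distr std_gaussian borel (\<lambda>w. A *v w)"
    using assms(2) unfolding multivariate_normal_def Z_def[symmetric] by auto
  \<comment> \<open>The rows of \<open>A\<close> split according to the two components: on the
    Gaussian space \<open>X\<close> becomes \<open>B *v w\<close> and \<open>Y\<close> becomes
    \<open>a \<bullet> w\<close>, and the covariance blocks are inner products of these
    rows.\<close>
  define B :: "real^('p + unit)^'p" where "B = (\<chi> j. A $ Inl j)"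
  define a where "a = A $ Inr ()"
  have rows: "A $ i \<bullet> A $ j = bordered_matrix S11 S12 S21 (\<sigma>Y\<^sup>2) $ i $ j" for i j
    unfolding A[symmetric] by (simp add: matrix_matrix_mult_def transpose_def inner_vec_def)
  have BB: "B ** transpose B = S11"
    using rows[of "Inl i" "Inl j" for i j]
    by (simp add: vec_eq_iff matrix_matrix_mult_def transpose_def inner_vec_def B_def bordered_matrix_def)
  have Ba: "B *v a = S12"
    using rows[of "Inl i" "Inr ()" for i]
    by (simp add: vec_eq_iff matrix_vector_mul_component B_def a_def bordered_matrix_def)
  have "S21 = B *v a"
    using rows[of "Inr ()" "Inl i" for i]
    by (simp add: vec_eq_iff matrix_vector_mul_component B_def a_def bordered_matrix_def inner_commute)
  then have S21: "S21 = S12"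
    by (simp add: Ba)
  have aa: "a \<bullet> a = \<sigma>Y\<^sup>2"
    using rows[of "Inr ()" "Inr ()"] by (simp add: a_def bordered_matrix_def)
  then have na: "norm a = \<sigma>Y"
    using assms(3) by (simp add: norm_eq_sqrt_inner)

  \<comment> \<open>\<open>b\<close> represents the regression part
    \<open>\<beta> \<bullet> X\<close> and \<open>e\<close> the residual. Geometrically
    \<open>a = b + e\<close> is the orthogonal decomposition of \<open>a\<close> along the row space
    and the kernel of \<open>B\<close>.\<close>
  define \<beta> where "\<beta> = G *v S12"
  define b where "b = transpose B *v \<beta>"
  define e where "e = a - b"
  have b: "b \<bullet> w = \<beta> \<bullet> (B *v w)" for w
    by (simp add: b_def transpose_matrix_vector dot_lmul_matrix)
  \<comment> \<open>\<open>S12 = B *v a\<close> lies in the column space of \<open>B\<close>, which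
    \<open>S11 ** G\<close> fixes.\<close>
  have "S11 *v \<beta> = S12"
    using generalized_inverse_Gram[of B G] assms(4)
    by (simp add: \<beta>_def Ba[symmetric] BB matrix_vector_mul_assoc matrix_mul_assoc)
  then have Bb: "B *v b = S12"
    by (simp add: b_def matrix_vector_mul_assoc BB del: transpose_matrix_vector)
  have Be: "B *v e = 0"
    by (simp add: e_def matrix_vector_mult_diff_distrib Ba Bb)
  have bb: "(norm b)\<^sup>2 = S21 \<bullet> (G *v S12)"
    by (simp add: power2_norm_eq_inner b Bb S21 \<beta>_def inner_commute)
  have "b \<bullet> e = 0"
    by (simp add: b Be)
  moreover have "a = b + e"
    by (simp add: e_def)
  ultimately have te: "(norm b)\<^sup>2 + (norm e)\<^sup>2 = \<sigma>Y\<^sup>2"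
    using aa by (simp add: power2_norm_eq_inner inner_add_left inner_add_right inner_commute)

  define \<pi>X :: "real^('p + unit) \<Rightarrow> real^'p" where "\<pi>X z = (\<chi> j. z $ Inl j)" for z
  have "linear \<pi>X"
    by (rule linearI) (simp_all add: \<pi>X_def vec_eq_iff)
  then have [measurable]: "\<pi>X \<in> borel_measurable borel"
    by (intro borel_measurable_continuous_onI linear_continuous_on) (simp add: linear_conv_bounded_linear)
  have [measurable]: "(\<lambda>z :: real^('p + unit). z $ Inr ()) \<in> borel_measurable borel"
    by (intro borel_measurable_continuous_onI continuous_intros)
  have linA: "(\<lambda>w. A *v w) \<in> borel_measurable borel"
    by (intro borel_measurable_continuous_onI linear_continuous_on) (simp add: linear_conv_bounded_linear[symmetric])
  have X: "X = (\<lambda>\<omega>. \<pi>X (Z \<omega>))" and Y: "Y = (\<lambda>\<omega>. Z \<omega> $ Inr ())"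
    by (simp_all add: Z_def append_scalar_def \<pi>X_def)
  have \<pi>A: "\<pi>X (A *v w) = B *v w" and AY: "(A *v w) $ Inr () = a \<bullet> w" for w
    by (simp_all add: \<pi>X_def vec_eq_iff matrix_vector_mul_component B_def a_def)
  \<comment> \<open>Only the joint law of \<open>X\<close> and \<open>Y\<close> is given, so every
    law needed is obtained by pushing it forward along a measurable \<open>h\<close>.\<close>
  have law: "distr M borel (\<lambda>\<omega>. h (Z \<omega>)) = distr std_gaussian borel (\<lambda>w. h (A *v w))"
    if "h \<in> borel_measurable borel" for h :: "real^('p + unit) \<Rightarrow> 'b::topological_space"
    using that linA distr_distr[of h borel borel Z M] distr_distr[of h borel borel "(\<lambda>w. A *v w)" std_gaussian]
    by (simp add: lawZ comp_def)
  have lawX: "distr M borel X = distr std_gaussian borel (\<lambda>w. B *v w)"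
    unfolding X by (subst law) (simp_all add: \<pi>A)

  have "xi M Y X = 3 / pi * arcsin ((1 + (norm b)\<^sup>2 / \<sigma>Y\<^sup>2) / 2) - 1 / 2"
  proof (rule xi_gaussian_regression[OF assms(1) _ _ _ _ _ assms(3) te, where \<beta>=\<beta>])
    show "X \<in> borel_measurable M" "Y \<in> borel_measurable M"
      unfolding X Y by measurable
    \<comment> \<open>The residual becomes \<open>e \<bullet> w\<close>, and
      \<open>B *v e = 0\<close> is exactly what makes it independent of
      \<open>B *v w\<close>.\<close>
    have "distr M borel (\<lambda>\<omega>. (Y \<omega> - \<beta> \<bullet> X \<omega>, X \<omega>)) = distr std_gaussian borel (\<lambda>w. (e \<bullet> w, B *v w))"
      unfolding X Y by (subst law[of "\<lambda>z. (z $ Inr () - \<beta> \<bullet> \<pi>X z, \<pi>X z)"])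
        (simp_all add: \<pi>A AY e_def inner_diff_left b)
    also have "\<dots> = distr std_normal_distribution borel (\<lambda>x. norm e * x) \<Otimes>\<^sub>M distr M borel X"
      unfolding lawX by (intro distr_std_gaussian_pair Be) simp
    finally show "distr M borel (\<lambda>\<omega>. (Y \<omega> - \<beta> \<bullet> X \<omega>, X \<omega>)) =
      distr std_normal_distribution borel (\<lambda>x. norm e * x) \<Otimes>\<^sub>M distr M borel X" .
    have "distr M borel (\<lambda>\<omega>. \<beta> \<bullet> X \<omega>) = distr std_gaussian borel (\<lambda>w. b \<bullet> w)"
      unfolding X by (subst law[of "\<lambda>z. \<beta> \<bullet> \<pi>X z"]) (simp_all add: \<pi>A b[symmetric])
    then show "distr M borel (\<lambda>\<omega>. \<beta> \<bullet> X \<omega>) = distr std_normal_distribution borel (\<lambda>x. norm b * x)"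
      by (simp add: distr_std_gaussian_inner)
    have "distr M borel Y = distr std_gaussian borel (\<lambda>w. a \<bullet> w)"
      unfolding Y by (subst law[of "\<lambda>z. z $ Inr ()"]) (simp_all add: AY)
    then show "distr M borel Y = distr std_normal_distribution borel (\<lambda>x. \<sigma>Y * x)"
      by (simp add: distr_std_gaussian_inner na)
  qed
  \<comment> \<open>The radicand is nonnegative because its numerator is the squared length of
    \<open>b\<close>, so squaring undoes the root.\<close>
  moreover have "(sqrt (S21 \<bullet> (G *v S12) / \<sigma>Y\<^sup>2))\<^sup>2 = (norm b)\<^sup>2 / \<sigma>Y\<^sup>2"
    unfolding bb[symmetric] by simp
  ultimately show ?thesis
    by (simp only: Let_def)
qed

end
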